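(* Let $T>0$, $\beta,\beta_0\in\mathbb{R}$, and let $H:\mathbb{R}^d\times\mathscr{P}_2(\mathbb{R}^d)\times\mathbb{R}^d\to\mathbb{R}$ and $G:\mathbb{R}^d\times\mathscr{P}_2(\mathbb{R}^d)\to\mathbb{R}$ be continuous, with $\partial_pH$ existing and continuous. Fix any $\alpha\in\mathbb{R}$ and set $$H_\alpha(x,\mu,p):=H(x,\mu,p-\alpha x),\qquad G_\alpha(x,\mu):=G(x,\mu)+\frac{\alpha}{2}|x|^2.$$ Then the master equation with data $(H,G)$ is well-posed if and only if the master equation with data $(H_\alpha,G_\alpha)$ is well-posed.
   Context: $\mathscr{P}_2(\mathbb{R}^d)$ is the set of Borel probability measures on $\mathbb{R}^d$ with finite second moment, with the 2-Wasserstein metric $W_2$; continuity in the measure variable is with respect to $W_2$. Derivatives in the measure: for $U:\mathscr{P}_2(\mathbb{R}^d)\to\mathbb{R}$, $\partial_\mu U(\mu,\tilde x)\in\mathbb{R}^d$ denotes the Wasserstein gradient (Lions derivative), i.e. the lift $\xi\mapsto U(\mathrm{Law}(\xi))$ on $L^2(\Omega;\mathbb{R}^d)$ is Fréchet differentiable with gradient $\partial_\mu U(\mathrm{Law}(\xi),\xi)$. Second derivatives $\partial_{x\mu}$, $\partial_{\tilde x\mu}$, $\partial_{\mu\mu}$ are derivatives of $\partial_\mu$ in $x$, $\tilde x$, $\mu$ ($\bar x$ being the additional variable for the second derivative in the measure). Master equation: given $T>0$, noise intensities $\beta,\beta_0\in\mathbb{R}$ (possibly zero) and data $(K,\Phi)$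 with $K:\mathbb{R}^d\times\mathscr{P}_2(\mathbb{R}^d)\times\mathbb{R}^d\to\mathbb{R}$, $\Phi:\mathbb{R}^d\times\mathscr{P}_2(\mathbb{R}^d)\to\mathbb{R}$, the master equation with data $(K,\Phi)$ is the problem for $V=V(t,x,\mu)$ $$-\partial_tV+K(x,\mu,\partial_xV)+\mathcal{N}V-\tfrac{\beta^2}{2}\Delta_{\rm ind}V-\tfrac{\beta_0^2}{2}\Delta_{\rm com}V=0\ \text{ in }(0,T)\times\mathbb{R}^d\times\mathscr{P}_2(\mathbb{R}^d),\qquad V(T,x,\mu)=\Phi(x,\mu),$$ where $$\mathcal{N}V(t,x,\mu)=\int_{\mathbb{R}^d}\partial_\mu V(t,x,\mu,\tilde x)\cdot\partial_pK(\tilde x,\mu,\partial_xV(t,\tilde x,\mu))\,d\mu(\tilde x),$$ $$\Delta_{\rm ind}V=\mathrm{tr}(\partial_{xx}V(t,x,\mu))+\int_{\mathbb{R}^d}\mathrm{tr}(\partial_{\tilde x\mu}V(t,x,\mu,\tilde x))\,d\mu(\tilde x),$$ $$\Delta_{\rm com}V=\mathrm{tr}(\partial_{xx}V)+\int\mathrm{tr}(\partial_{\tilde x\mu}V(t,x,\mu,\tilde x))\,d\mu(\tilde x)+2\int\mathrm{tr}(\partial_{x\mu}V(t,x,\mu,\tilde x))\,d\mu(\tilde x)+\iint\mathrm{tr}(\partial_{\mu\mu}V(t,x,\mu,\tilde x,\bar x))\,d\mu(\tilde x)\,d\mu(\bar x).$$ Well-posedness is understood in the sense of classical solutions: there exists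 a unique classical solution, i.e. a continuous $V$ on $(0,T]\times\mathbb{R}^d\times\mathscr{P}_2(\mathbb{R}^d)$ for which all derivatives appearing in the equation exist and are continuous, the integrals are well defined, and the equation and terminal condition hold pointwise (terms with zero coefficient are absent). *)

theory Defs
  imports "HOL-Probability.Probability"
begin

section \<open>The Wasserstein space\<close>

definition P2 :: "(real^'d) measure set" where
  "P2 = {\<mu>. prob_space \<mu> \<and> sets \<mu> = sets borel \<and> integrable \<mu> (\<lambda>x. (norm x)\<^sup>2)}"

definition couplings ::
  "(real^'d) measure \<Rightarrow> (real^'d) measure \<Rightarrow> ((real^'d) \<times> (real^'d)) measure set" where
  "couplings \<mu> \<nu> =
     {\<pi>. sets \<pi> = sets borel \<and> distr \<pi> borel fst = \<mu> \<and> distr \<pi> borel snd = \<nu>}"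

definition W2 :: "(real^'d) measure \<Rightarrow> (real^'d) measure \<Rightarrow> real" where
  "W2 \<mu> \<nu> = sqrt (INF \<pi>\<in>couplings \<mu> \<nu>. \<integral>z. (dist (fst z) (snd z))\<^sup>2 \<partial>\<pi>)"

text \<open>
  Joint continuity on \<open>S \<times> P2\<close>, where the measure variable carries \<^const>\<open>W2\<close>. All variables
  other than the measure are collected in one tuple.
\<close>

definition continuous_P2_on ::
  "'e::metric_space set \<Rightarrow> ('e \<Rightarrow> (real^'d) measure \<Rightarrow> 'b::metric_space) \<Rightarrow> bool" where
  "continuous_P2_on S f \<longleftrightarrow>
     (\<forall>e\<in>S. \<forall>\<mu>\<in>P2. \<forall>\<epsilon>>0. \<exists>\<delta>>0. \<forall>e'\<in>S. \<forall>\<nu>\<in>P2.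
        dist e' e < \<delta> \<and> W2 \<nu> \<mu> < \<delta> \<longrightarrow> dist (f e' \<nu>) (f e \<mu>) < \<epsilon>)"


section \<open>Derivatives\<close>

definition gradient :: "('a::real_inner \<Rightarrow> real) \<Rightarrow> 'a \<Rightarrow> 'a" where
  "gradient f x = (THE D. GDERIV f x :> D)"

lemma gradient_eqI:
  assumes "GDERIV f x :> D"
  shows "gradient f x = D"
proof -
  have "E = D" if "GDERIV f x :> E" for E
  proof -
    have "(\<lambda>h. inner h E) = (\<lambda>h. inner h D)"
      using that assms unfolding gderiv_def by (rule has_derivative_unique)
    then have "\<forall>h. inner h E = inner h D" by meson
    then show ?thesis by (simp add: vector_eq_ldot)
  qed
  then show ?thesis
    unfolding gradient_def using assms by (intro the_equality)
qed

definition has_jacobian :: "(real^'d \<Rightarrow> real^'d) \<Rightarrow> real^'d^'d \<Rightarrow> real^'d \<Rightarrow> bool" where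
  "has_jacobian f A x \<longleftrightarrow> (f has_derivative (\<lambda>h. A *v h)) (at x)"

text \<open>
  An atomless probability space carries a random variable with any prescribed law on
  \<open>\<real>\<^sup>d\<close>; this is the richness required of the space on which functions of measures are lifted.
\<close>

definition atomless_prob_space :: "'w measure \<Rightarrow> bool" where
  "atomless_prob_space \<Omega> \<longleftrightarrow> prob_space \<Omega> \<and>
     (\<forall>A\<in>sets \<Omega>. measure \<Omega> A > 0 \<longrightarrow>
        (\<exists>B\<in>sets \<Omega>. B \<subseteq> A \<and> 0 < measure \<Omega> B \<and> measure \<Omega> B < measure \<Omega> A))"

definition L2 :: "'w measure \<Rightarrow> ('w \<Rightarrow> real^'d) set" where
  "L2 \<Omega> = {\<xi>. \<xi> \<in> borel_measurable \<Omega> \<and> integrable \<Omega> (\<lambda>\<omega>. (norm (\<xi> \<omega>))\<^sup>2)}"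

definition L2_norm :: "'w measure \<Rightarrow> ('w \<Rightarrow> real^'d) \<Rightarrow> real" where
  "L2_norm \<Omega> \<xi> = sqrt (\<integral>\<omega>. (norm (\<xi> \<omega>))\<^sup>2 \<partial>\<Omega>)"

abbreviation Law :: "'w measure \<Rightarrow> ('w \<Rightarrow> real^'d) \<Rightarrow> (real^'d) measure" where
  "Law \<Omega> \<xi> \<equiv> distr \<Omega> borel \<xi>"

text \<open>
  Frechet differentiability on \<open>L\<^sup>2(\<Omega>; \<real>\<^sup>d)\<close> with gradient \<open>\<zeta>\<close> (identified with the
  derivative through the inner product). Elements of \<open>L\<^sup>2\<close> are represented by functions; this
  is only applied to lifts, which are invariant under almost sure equality.
\<close>

definition has_L2_gradient ::
  "'w measure \<Rightarrow> (('w \<Rightarrow> real^'d) \<Rightarrow> real) \<Rightarrow> ('w \<Rightarrow> real^'d) \<Rightarrow> ('w \<Rightarrow> real^'d) \<Rightarrow> bool" where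
  "has_L2_gradient \<Omega> F \<zeta> \<xi> \<longleftrightarrow> \<zeta> \<in> L2 \<Omega> \<and>
     (\<forall>\<epsilon>>0. \<exists>\<delta>>0. \<forall>\<eta>\<in>L2 \<Omega>. L2_norm \<Omega> \<eta> < \<delta> \<longrightarrow>
        \<bar>F (\<lambda>\<omega>. \<xi> \<omega> + \<eta> \<omega>) - F \<xi> - (\<integral>\<omega>. \<zeta> \<omega> \<bullet> \<eta> \<omega> \<partial>\<Omega>)\<bar> \<le> \<epsilon> * L2_norm \<Omega> \<eta>)"

definition has_lions_derivative ::
  "'w measure \<Rightarrow> ((real^'d) measure \<Rightarrow> real) \<Rightarrow> ((real^'d) measure \<Rightarrow> real^'d \<Rightarrow> real^'d) \<Rightarrow> bool"
  where
  "has_lions_derivative \<Omega> U DU \<longleftrightarrow>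
     (\<forall>\<xi>\<in>L2 \<Omega>. has_L2_gradient \<Omega> (\<lambda>\<zeta>. U (Law \<Omega> \<zeta>)) (\<lambda>\<omega>. DU (Law \<Omega> \<xi>) (\<xi> \<omega>)) \<xi>)"


section \<open>The master equation\<close>

text \<open>
  Naming of derivatives of \<open>V(t,x,\<mu>)\<close>: in the suffixes, \<open>m\<close> is the measure and \<open>y\<close> the variable
  \<open>\<tilde>x\<close>, so \<open>Vm\<close>, \<open>Vym\<close>, \<open>Vxm\<close>, \<open>Vmm\<close> are
  \<open>\<partial>\<^sub>\<mu>V\<close> and its derivatives in \<open>\<tilde>x\<close>, \<open>x\<close>, \<open>\<mu>\<close>.
\<close>

definition transport_term ::
  "(real^'d \<Rightarrow> (real^'d) measure \<Rightarrow> real^'d \<Rightarrow> real) \<Rightarrow>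
   (real^'d \<Rightarrow> (real^'d) measure \<Rightarrow> real^'d) \<Rightarrow>
   (real^'d \<Rightarrow> (real^'d) measure \<Rightarrow> real^'d \<Rightarrow> real^'d) \<Rightarrow>
   real^'d \<Rightarrow> (real^'d) measure \<Rightarrow> real" where
  "transport_term K Vx Vm x \<mu> = (\<integral>y. Vm x \<mu> y \<bullet> gradient (K y \<mu>) (Vx y \<mu>) \<partial>\<mu>)"

definition ind_laplacian ::
  "(real^'d \<Rightarrow> (real^'d) measure \<Rightarrow> real^'d^'d) \<Rightarrow>
   (real^'d \<Rightarrow> (real^'d) measure \<Rightarrow> real^'d \<Rightarrow> real^'d^'d) \<Rightarrow>
   real^'d \<Rightarrow> (real^'d) measure \<Rightarrow> real" where
  "ind_laplacian Vxx Vym x \<mu> = trace (Vxx x \<mu>) + (\<integral>y. trace (Vym x \<mu> y) \<partial>\<mu>)"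

definition com_laplacian ::
  "(real^'d \<Rightarrow> (real^'d) measure \<Rightarrow> real^'d^'d) \<Rightarrow>
   (real^'d \<Rightarrow> (real^'d) measure \<Rightarrow> real^'d \<Rightarrow> real^'d^'d) \<Rightarrow>
   (real^'d \<Rightarrow> (real^'d) measure \<Rightarrow> real^'d \<Rightarrow> real^'d^'d) \<Rightarrow>
   (real^'d \<Rightarrow> (real^'d) measure \<Rightarrow> real^'d \<Rightarrow> real^'d \<Rightarrow> real^'d^'d) \<Rightarrow>
   real^'d \<Rightarrow> (real^'d) measure \<Rightarrow> real" where
  "com_laplacian Vxx Vym Vxm Vmm x \<mu> =
     trace (Vxx x \<mu>) + (\<integral>y. trace (Vym x \<mu> y) \<partial>\<mu>) + 2 * (\<integral>y. trace (Vxm x \<mu> y) \<partial>\<mu>)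
     + (\<integral>(y, z). trace (Vmm x \<mu> y z) \<partial>(\<mu> \<Otimes>\<^sub>M \<mu>))"

text \<open>
  The derivatives are existentially quantified. This does not leave a real choice: the Lions
  derivative at \<open>\<mu>\<close> is determined only \<open>\<mu>\<close>-almost everywhere, but its jointly continuous version
  is unique, since the measures of full support are dense. Derivatives occurring only in a term
  with zero coefficient are not required to exist. The derivative \<open>\<partial>\<^sub>\<mu>\<^sub>\<mu>V\<close> is taken
  componentwise: row \<open>i\<close> of the matrix \<open>Vmm\<close> is the Lions derivative of component \<open>i\<close>
  of \<open>\<partial>\<^sub>\<mu>V\<close>.
\<close>

definition classical_solution ::
  "'w measure \<Rightarrow> real \<Rightarrow> real \<Rightarrow> real \<Rightarrow>
   (real^'d \<Rightarrow> (real^'d) measure \<Rightarrow> real^'d \<Rightarrow> real) \<Rightarrow>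
   (real^'d \<Rightarrow> (real^'d) measure \<Rightarrow> real) \<Rightarrow>
   (real \<Rightarrow> real^'d \<Rightarrow> (real^'d) measure \<Rightarrow> real) \<Rightarrow> bool" where
  "classical_solution \<Omega> T \<beta> \<beta>0 K \<Phi> V \<longleftrightarrow>
     continuous_P2_on ({0<..T} \<times> UNIV) (\<lambda>(t, x) \<mu>. V t x \<mu>) \<and>
     (\<forall>x. \<forall>\<mu>\<in>P2. V T x \<mu> = \<Phi> x \<mu>) \<and>
     (\<exists>Vt Vx Vm Vxx Vym Vxm Vmm.
        \<comment> \<open>first-order derivatives\<close>
        continuous_P2_on ({0<..<T} \<times> UNIV) (\<lambda>(t, x) \<mu>. Vt t x \<mu>) \<and>
        continuous_P2_on ({0<..<T} \<times> UNIV) (\<lambda>(t, x) \<mu>. Vx t x \<mu>) \<and>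
        continuous_P2_on ({0<..<T} \<times> UNIV \<times> UNIV) (\<lambda>(t, x, y) \<mu>. Vm t x \<mu> y) \<and>
        (\<forall>t\<in>{0<..<T}. \<forall>x. \<forall>\<mu>\<in>P2.
           ((\<lambda>s. V s x \<mu>) has_real_derivative Vt t x \<mu>) (at t) \<and>
           (GDERIV (\<lambda>x. V t x \<mu>) x :> Vx t x \<mu>)) \<and>
        (\<forall>t\<in>{0<..<T}. \<forall>x. has_lions_derivative \<Omega> (V t x) (Vm t x)) \<and>
        (\<forall>t\<in>{0<..<T}. \<forall>x. \<forall>\<mu>\<in>P2.
           integrable \<mu> (\<lambda>y. Vm t x \<mu> y \<bullet> gradient (K y \<mu>) (Vx t y \<mu>))) \<and>
        \<comment> \<open>second-order derivatives common to both noise terms\<close>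
        (\<beta> \<noteq> 0 \<or> \<beta>0 \<noteq> 0 \<longrightarrow>
           continuous_P2_on ({0<..<T} \<times> UNIV) (\<lambda>(t, x) \<mu>. Vxx t x \<mu>) \<and>
           continuous_P2_on ({0<..<T} \<times> UNIV \<times> UNIV) (\<lambda>(t, x, y) \<mu>. Vym t x \<mu> y) \<and>
           (\<forall>t\<in>{0<..<T}. \<forall>x. \<forall>\<mu>\<in>P2.
              has_jacobian (\<lambda>x. Vx t x \<mu>) (Vxx t x \<mu>) x \<and>
              (\<forall>y. has_jacobian (\<lambda>y. Vm t x \<mu> y) (Vym t x \<mu> y) y) \<and>
              integrable \<mu> (\<lambda>y. trace (Vym t x \<mu> y)))) \<and>
        \<comment> \<open>second-order derivatives of the common noise term\<close>
        (\<beta>0 \<noteq> 0 \<longrightarrow>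
           continuous_P2_on ({0<..<T} \<times> UNIV \<times> UNIV) (\<lambda>(t, x, y) \<mu>. Vxm t x \<mu> y) \<and>
           continuous_P2_on ({0<..<T} \<times> UNIV \<times> UNIV \<times> UNIV)
             (\<lambda>(t, x, y, z) \<mu>. Vmm t x \<mu> y z) \<and>
           (\<forall>t\<in>{0<..<T}. \<forall>x. \<forall>\<mu>\<in>P2.
              (\<forall>y. has_jacobian (\<lambda>x. Vm t x \<mu> y) (Vxm t x \<mu> y) x) \<and>
              integrable \<mu> (\<lambda>y. trace (Vxm t x \<mu> y)) \<and>
              integrable (\<mu> \<Otimes>\<^sub>M \<mu>) (\<lambda>(y, z). trace (Vmm t x \<mu> y z))) \<and>
           (\<forall>t\<in>{0<..<T}. \<forall>x y i.
              has_lions_derivative \<Omega> (\<lambda>\<mu>. Vm t x \<mu> y $ i) (\<lambda>\<mu> z. Vmm t x \<mu> y z $ i))) \<and>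
        (\<forall>t\<in>{0<..<T}. \<forall>x. \<forall>\<mu>\<in>P2.
           - Vt t x \<mu> + K x \<mu> (Vx t x \<mu>) + transport_term K (Vx t) (Vm t) x \<mu>
           - \<beta>\<^sup>2 / 2 * ind_laplacian (Vxx t) (Vym t) x \<mu>
           - \<beta>0\<^sup>2 / 2 * com_laplacian (Vxx t) (Vym t) (Vxm t) (Vmm t) x \<mu> = 0))"

definition master_well_posed ::
  "'w measure \<Rightarrow> real \<Rightarrow> real \<Rightarrow> real \<Rightarrow>
   (real^'d \<Rightarrow> (real^'d) measure \<Rightarrow> real^'d \<Rightarrow> real) \<Rightarrow>
   (real^'d \<Rightarrow> (real^'d) measure \<Rightarrow> real) \<Rightarrow> bool" where
  "master_well_posed \<Omega> T \<beta> \<beta>0 K \<Phi> \<longleftrightarrow>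
     (\<exists>V. classical_solution \<Omega> T \<beta> \<beta>0 K \<Phi> V \<and>
        (\<forall>V'. classical_solution \<Omega> T \<beta> \<beta>0 K \<Phi> V' \<longrightarrow>
           (\<forall>t\<in>{0<..T}. \<forall>x. \<forall>\<mu>\<in>P2. V' t x \<mu> = V t x \<mu>)))"

end

theory Submission
  imports Defs
begin

text \<open>
  Adding \<open>\<alpha>/2 |x|\<^sup>2 + \<alpha> d (\<beta>\<^sup>2 + \<beta>\<^sub>0\<^sup>2)/2 (T - t)\<close> to a solution \<open>V\<close> for the data \<open>(H, G)\<close>
  gives a solution for \<open>(H\<^sub>\<alpha>, G\<^sub>\<alpha>)\<close>. The quadratic part shifts \<open>\<partial>\<^sub>xV\<close> by \<open>\<alpha>x\<close>, which the shift
  of the momentum in \<open>H\<^sub>\<alpha>\<close> undoes, and shifts \<open>tr \<partial>\<^sub>x\<^sub>xV\<close> by \<open>\<alpha> d\<close>, which the part affine in \<open>t\<close>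
  compensates; no derivative in the measure changes. The transformation is inverted by \<open>-\<alpha>\<close>, so
  it is a bijection between the solutions of the two problems.
\<close>

text \<open>Every correction to \<open>V\<close> and its derivatives is a function of
  \<open>(t, x)\<close> alone, so \<open>W2\<close> has to be controlled only for \<open>f\<close>.
  The general normed codomain lets one lemma serve the scalar, vector and matrix valued
  cases.\<close>

lemma continuous_P2_on_add_const_measure:
  fixes f :: "'e::metric_space \<Rightarrow> (real^'d) measure \<Rightarrow> 'b::real_normed_vector"
  assumes f: "continuous_P2_on S f" and g: "continuous_on S g"
  shows "continuous_P2_on S (\<lambda>e \<mu>. f e \<mu> + g e)"
  unfolding continuous_P2_on_def
proof (intro ballI allI impI)
  fix e and \<mu> :: "(real^'d) measure" and \<epsilon> :: real
  assume e: "e \<in> S" and \<mu>: "\<mu> \<in> P2" and \<epsilon>: "0 < \<epsilon>"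
  then have \<epsilon>2: "0 < \<epsilon> / 2" by simp
  obtain \<delta>1 where \<delta>1: "\<delta>1 > 0"
    "\<And>e' \<nu>. \<lbrakk>e' \<in> S; \<nu> \<in> P2; dist e' e < \<delta>1; W2 \<nu> \<mu> < \<delta>1\<rbrakk> \<Longrightarrow> dist (f e' \<nu>) (f e \<mu>) < \<epsilon> / 2"
    using f e \<mu> \<epsilon>2 unfolding continuous_P2_on_def by meson
  obtain \<delta>2 where \<delta>2: "\<delta>2 > 0" "\<And>e'. \<lbrakk>e' \<in> S; dist e' e < \<delta>2\<rbrakk> \<Longrightarrow> dist (g e') (g e) < \<epsilon> / 2"
    using g e \<epsilon>2 unfolding continuous_on_iff by meson
  have "dist (f e' \<nu> + g e') (f e \<mu> + g e) < \<epsilon>"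
    if "e' \<in> S" "\<nu> \<in> P2" "dist e' e < min \<delta>1 \<delta>2" "W2 \<nu> \<mu> < min \<delta>1 \<delta>2" for e' \<nu>
    using dist_triangle_add[of "f e' \<nu>" "g e'" "f e \<mu>" "g e"] \<delta>1(2)[of e' \<nu>] \<delta>2(2)[of e'] that
    by simp
  then show "\<exists>\<delta>>0. \<forall>e'\<in>S. \<forall>\<nu>\<in>P2. dist e' e < \<delta> \<and> W2 \<nu> \<mu> < \<delta> \<longrightarrow>
      dist (f e' \<nu> + g e') (f e \<mu> + g e) < \<epsilon>"
    using \<delta>1(1) \<delta>2(1) by (intro exI[of _ "min \<delta>1 \<delta>2"]) auto
qed

text \<open>Translation has the identity as derivative, so the chain rule preserves
  \<open>D\<close>. Having both directions makes the sets of possible gradients equal, which is what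
  a definite description requires.\<close>

lemma GDERIV_shift:
  "(GDERIV (\<lambda>p. f (p - a)) x :> D) \<longleftrightarrow> (GDERIV f (x - a) :> D)"
proof
  assume "GDERIV f (x - a) :> D"
  then show "GDERIV (\<lambda>p. f (p - a)) x :> D"
    unfolding gderiv_def
    by (rule has_derivative_compose[rotated]) (auto intro!: derivative_eq_intros)
next
  assume "GDERIV (\<lambda>p. f (p - a)) x :> D"
  \<comment> \<open>Writing \<open>x\<close> as \<open>(x - a) + a\<close> exhibits the converse as
    composition with the inverse translation.\<close>
  then have "((\<lambda>p. f (p - a)) has_derivative (\<lambda>h. inner h D)) (at ((x - a) + a))"
    by (simp add: gderiv_def)
  then have "((\<lambda>z. f ((z + a) - a)) has_derivative (\<lambda>h. inner h D)) (at (x - a))"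
    by (rule has_derivative_compose[rotated]) (auto intro!: derivative_eq_intros)
  then show "GDERIV f (x - a) :> D"
    by (simp add: gderiv_def)
qed

text \<open>Both sides describe the unique element of the same predicate, so they agree even where
  no derivative exists and the value is unspecified.\<close>

lemma gradient_shift: "gradient (\<lambda>p. f (p - a)) x = gradient f (x - a)"
  by (simp add: gradient_def GDERIV_shift)

lemma GDERIV_half_norm_power2:
  fixes x :: "'a::real_inner"
  shows "GDERIV (\<lambda>x. \<alpha> / 2 * (norm x)\<^sup>2) x :> \<alpha> *\<^sub>R x"
  unfolding gderiv_def power2_norm_eq_inner
  by (auto intro!: derivative_eq_intros simp: inner_commute)

lemma has_jacobian_add_scaleR:
  assumes "has_jacobian f A x"
  shows "has_jacobian (\<lambda>x. f x + \<alpha> *\<^sub>R x) (A + \<alpha> *\<^sub>R mat 1) x"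
  using assms unfolding has_jacobian_def
  by (auto intro!: derivative_eq_intros
      simp: matrix_vector_mult_add_rdistrib scaleR_matrix_vector_assoc[symmetric])

lemma trace_add_scaleR_mat_1:
  fixes A :: "real^'d^'d"
  shows "trace (A + \<alpha> *\<^sub>R mat 1) = trace A + \<alpha> * CARD('d)"
  by (simp add: trace_def mat_def sum.distrib)

text \<open>The constant cancels in the increment of the lift. It is applied at fixed
  \<open>t\<close> and \<open>x\<close>, where the whole correction to \<open>V\<close> is a
  constant in the measure.\<close>

lemma has_lions_derivative_add_const:
  "has_lions_derivative \<Omega> U DU \<Longrightarrow> has_lions_derivative \<Omega> (\<lambda>\<mu>. U \<mu> + c) DU"
  by (simp add: has_lions_derivative_def has_L2_gradient_def)

definition shift_hamiltonian ::
  "real \<Rightarrow> (real^'d \<Rightarrow> (real^'d) measure \<Rightarrow> real^'d \<Rightarrow> real) \<Rightarrow>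
   real^'d \<Rightarrow> (real^'d) measure \<Rightarrow> real^'d \<Rightarrow> real" where
  "shift_hamiltonian \<alpha> K = (\<lambda>x \<mu> p. K x \<mu> (p - \<alpha> *\<^sub>R x))"

definition shift_terminal ::
  "real \<Rightarrow> (real^'d \<Rightarrow> (real^'d) measure \<Rightarrow> real) \<Rightarrow> real^'d \<Rightarrow> (real^'d) measure \<Rightarrow> real" where
  "shift_terminal \<alpha> \<Phi> = (\<lambda>x \<mu>. \<Phi> x \<mu> + \<alpha> / 2 * (norm x)\<^sup>2)"

text \<open>The slope in \<open>t\<close> balances the multiples of \<alpha> d that the two
  Laplacians gain, weighted by their coefficients. The factor \<open>T - t\<close> vanishes at the
  terminal time, so only the quadratic part reaches the terminal data.\<close>

definition shift_solution ::
  "real \<Rightarrow> real \<Rightarrow> real \<Rightarrow> real \<Rightarrow> (real \<Rightarrow> real^'d \<Rightarrow> (real^'d) measure \<Rightarrow> real) \<Rightarrow>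
   real \<Rightarrow> real^'d \<Rightarrow> (real^'d) measure \<Rightarrow> real" where
  "shift_solution T \<beta> \<beta>0 \<alpha> V = (\<lambda>t x \<mu>.
     V t x \<mu> + (\<alpha> / 2 * (norm x)\<^sup>2 + \<alpha> * CARD('d) * (\<beta>\<^sup>2 + \<beta>0\<^sup>2) / 2 * (T - t)))"

lemma shift_hamiltonian_inverse: "shift_hamiltonian (- \<alpha>) (shift_hamiltonian \<alpha> K) = K"
  by (simp add: shift_hamiltonian_def)

lemma shift_terminal_inverse: "shift_terminal (- \<alpha>) (shift_terminal \<alpha> \<Phi>) = \<Phi>"
  by (simp add: shift_terminal_def)

text \<open>The cancellation happens inside the integrand: at the integration point
  \<open>y\<close>, the momentum is raised by \<alpha> y and the Hamiltonian lowers it by the same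
  vector.\<close>

lemma transport_term_shift:
  "transport_term (shift_hamiltonian \<alpha> K) (\<lambda>x \<mu>. Vx x \<mu> + \<alpha> *\<^sub>R x) Vm x \<mu> =
   transport_term K Vx Vm x \<mu>"
  by (simp add: transport_term_def shift_hamiltonian_def gradient_shift)

lemma ind_laplacian_shift:
  fixes Vxx :: "real^'d \<Rightarrow> (real^'d) measure \<Rightarrow> real^'d^'d"
  shows "ind_laplacian (\<lambda>x \<mu>. Vxx x \<mu> + \<alpha> *\<^sub>R mat 1) Vym x \<mu> =
    ind_laplacian Vxx Vym x \<mu> + \<alpha> * CARD('d)"
  by (simp add: ind_laplacian_def trace_add_scaleR_mat_1)

lemma com_laplacian_shift:
  fixes Vxx :: "real^'d \<Rightarrow> (real^'d) measure \<Rightarrow> real^'d^'d"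
  shows "com_laplacian (\<lambda>x \<mu>. Vxx x \<mu> + \<alpha> *\<^sub>R mat 1) Vym Vxm Vmm x \<mu> =
    com_laplacian Vxx Vym Vxm Vmm x \<mu> + \<alpha> * CARD('d)"
  by (simp add: com_laplacian_def trace_add_scaleR_mat_1)

text \<open>The derivatives of \<open>V\<close> yield explicit witnesses: \<open>Vt\<close>,
  \<open>Vx\<close> and \<open>Vxx\<close> receive corrections, while \<open>Vm\<close>,
  \<open>Vym\<close>, \<open>Vxm\<close> and \<open>Vmm\<close> are reused. Since \<open>K\<close>,
  \<open>\<Phi>\<close> and \<alpha> are arbitrary, the lemma also applies to shifted data with -
  \<alpha>.\<close>

lemma classical_solution_shift:
  fixes V :: "real \<Rightarrow> real^'d \<Rightarrow> (real^'d) measure \<Rightarrow> real"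
  assumes "classical_solution \<Omega> T \<beta> \<beta>0 K \<Phi> V"
  shows "classical_solution \<Omega> T \<beta> \<beta>0 (shift_hamiltonian \<alpha> K) (shift_terminal \<alpha> \<Phi>)
    (shift_solution T \<beta> \<beta>0 \<alpha> V)"
proof -
  define c where "c = \<alpha> * CARD('d) * (\<beta>\<^sup>2 + \<beta>0\<^sup>2) / 2"
  let ?K = "shift_hamiltonian \<alpha> K" and ?V = "shift_solution T \<beta> \<beta>0 \<alpha> V"
  have V_shift: "?V = (\<lambda>t x \<mu>. V t x \<mu> + (\<alpha> / 2 * (norm x)\<^sup>2 + c * (T - t)))"
    by (simp add: shift_solution_def c_def)
  have V_cont: "continuous_P2_on ({0<..T} \<times> UNIV) (\<lambda>(t, x) \<mu>. V t x \<mu>)"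
    and V_T: "\<forall>x. \<forall>\<mu>\<in>P2. V T x \<mu> = \<Phi> x \<mu>"
    using assms by (simp_all add: classical_solution_def)
  obtain Vt Vx Vm Vxx Vym Vxm Vmm where
      Vt_cont: "continuous_P2_on ({0<..<T} \<times> UNIV) (\<lambda>(t, x) \<mu>. Vt t x \<mu>)"
    and Vx_cont: "continuous_P2_on ({0<..<T} \<times> UNIV) (\<lambda>(t, x) \<mu>. Vx t x \<mu>)"
    and Vm_cont: "continuous_P2_on ({0<..<T} \<times> UNIV \<times> UNIV) (\<lambda>(t, x, y) \<mu>. Vm t x \<mu> y)"
    and first: "\<forall>t\<in>{0<..<T}. \<forall>x. \<forall>\<mu>\<in>P2.
      ((\<lambda>s. V s x \<mu>) has_real_derivative Vt t x \<mu>) (at t) \<and>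
      (GDERIV (\<lambda>x. V t x \<mu>) x :> Vx t x \<mu>)"
    and Vm: "\<forall>t\<in>{0<..<T}. \<forall>x. has_lions_derivative \<Omega> (V t x) (Vm t x)"
    and transport: "\<forall>t\<in>{0<..<T}. \<forall>x. \<forall>\<mu>\<in>P2.
      integrable \<mu> (\<lambda>y. Vm t x \<mu> y \<bullet> gradient (K y \<mu>) (Vx t y \<mu>))"
    and second: "\<beta> \<noteq> 0 \<or> \<beta>0 \<noteq> 0 \<longrightarrow>
      continuous_P2_on ({0<..<T} \<times> UNIV) (\<lambda>(t, x) \<mu>. Vxx t x \<mu>) \<and>
      continuous_P2_on ({0<..<T} \<times> UNIV \<times> UNIV) (\<lambda>(t, x, y) \<mu>. Vym t x \<mu> y) \<and>
      (\<forall>t\<in>{0<..<T}. \<forall>x. \<forall>\<mu>\<in>P2.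
         has_jacobian (\<lambda>x. Vx t x \<mu>) (Vxx t x \<mu>) x \<and>
         (\<forall>y. has_jacobian (\<lambda>y. Vm t x \<mu> y) (Vym t x \<mu> y) y) \<and>
         integrable \<mu> (\<lambda>y. trace (Vym t x \<mu> y)))"
    and common: "\<beta>0 \<noteq> 0 \<longrightarrow>
      continuous_P2_on ({0<..<T} \<times> UNIV \<times> UNIV) (\<lambda>(t, x, y) \<mu>. Vxm t x \<mu> y) \<and>
      continuous_P2_on ({0<..<T} \<times> UNIV \<times> UNIV \<times> UNIV) (\<lambda>(t, x, y, z) \<mu>. Vmm t x \<mu> y z) \<and>
      (\<forall>t\<in>{0<..<T}. \<forall>x. \<forall>\<mu>\<in>P2.
         (\<forall>y. has_jacobian (\<lambda>x. Vm t x \<mu> y) (Vxm t x \<mu> y) x) \<and>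
         integrable \<mu> (\<lambda>y. trace (Vxm t x \<mu> y)) \<and>
         integrable (\<mu> \<Otimes>\<^sub>M \<mu>) (\<lambda>(y, z). trace (Vmm t x \<mu> y z))) \<and>
      (\<forall>t\<in>{0<..<T}. \<forall>x y i.
         has_lions_derivative \<Omega> (\<lambda>\<mu>. Vm t x \<mu> y $ i) (\<lambda>\<mu> z. Vmm t x \<mu> y z $ i))"
    and eqn: "\<forall>t\<in>{0<..<T}. \<forall>x. \<forall>\<mu>\<in>P2.
      - Vt t x \<mu> + K x \<mu> (Vx t x \<mu>) + transport_term K (Vx t) (Vm t) x \<mu>
      - \<beta>\<^sup>2 / 2 * ind_laplacian (Vxx t) (Vym t) x \<mu>
      - \<beta>0\<^sup>2 / 2 * com_laplacian (Vxx t) (Vym t) (Vxm t) (Vmm t) x \<mu> = 0"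
    using assms unfolding classical_solution_def by (elim conjE exE) (rule that)

  \<comment> \<open>The term \<open>c * (T - t)\<close> has time derivative - c; writing it as an
    added \<open>- c\<close> fits the continuity lemma for sums.\<close>
  define Wt where "Wt = (\<lambda>t x \<mu>. Vt t x \<mu> + - c)"
  define Wx where "Wx = (\<lambda>t x \<mu>. Vx t x \<mu> + \<alpha> *\<^sub>R x)"
  define Wxx where "Wxx = (\<lambda>t x \<mu>. Vxx t x \<mu> + \<alpha> *\<^sub>R (mat 1 :: real^'d^'d))"

  have "continuous_P2_on ({0<..T} \<times> UNIV) (\<lambda>(t, x) \<mu>. ?V t x \<mu>)"
    unfolding V_shift split_beta
    by (intro continuous_P2_on_add_const_measure continuous_intros V_cont[unfolded split_beta])
  moreover have "\<forall>x. \<forall>\<mu>\<in>P2. ?V T x \<mu> = shift_terminal \<alpha> \<Phi> x \<mu>"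
    using V_T by (simp add: V_shift shift_terminal_def)
  moreover have "continuous_P2_on ({0<..<T} \<times> UNIV) (\<lambda>(t, x) \<mu>. Wt t x \<mu>)"
    unfolding Wt_def split_beta
    by (intro continuous_P2_on_add_const_measure continuous_intros Vt_cont[unfolded split_beta])
  moreover have "continuous_P2_on ({0<..<T} \<times> UNIV) (\<lambda>(t, x) \<mu>. Wx t x \<mu>)"
    unfolding Wx_def split_beta
    by (intro continuous_P2_on_add_const_measure continuous_intros Vx_cont[unfolded split_beta])
  moreover have "\<forall>t\<in>{0<..<T}. \<forall>x. \<forall>\<mu>\<in>P2.
      ((\<lambda>s. ?V s x \<mu>) has_real_derivative Wt t x \<mu>) (at t) \<and>
      (GDERIV (\<lambda>x. ?V t x \<mu>) x :> Wx t x \<mu>)"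
  proof (intro ballI allI conjI)
    fix t x \<mu> assume t: "t \<in> {0<..<T}" and \<mu>: "\<mu> \<in> (P2 :: (real^'d) measure set)"
    have Vt: "((\<lambda>s. V s x \<mu>) has_real_derivative Vt t x \<mu>) (at t)"
      and Vx: "GDERIV (\<lambda>x. V t x \<mu>) x :> Vx t x \<mu>"
      using first t \<mu> by auto
    show "((\<lambda>s. ?V s x \<mu>) has_real_derivative Wt t x \<mu>) (at t)"
      unfolding V_shift Wt_def by (auto intro!: derivative_eq_intros Vt)
    show "GDERIV (\<lambda>x. ?V t x \<mu>) x :> Wx t x \<mu>"
      unfolding V_shift Wx_def
      \<comment> \<open>In the variable \<open>x\<close> the time part of the correction is constant
        and contributes a zero gradient.\<close>
      using GDERIV_add[OF Vx GDERIV_add[OF GDERIV_half_norm_power2[of \<alpha> x] GDERIV_const]]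
      by simp
  qed
  moreover have "\<forall>t\<in>{0<..<T}. \<forall>x. has_lions_derivative \<Omega> (?V t x) (Vm t x)"
    using Vm by (simp add: V_shift has_lions_derivative_add_const)
  moreover have "\<forall>t\<in>{0<..<T}. \<forall>x. \<forall>\<mu>\<in>P2.
      integrable \<mu> (\<lambda>y. Vm t x \<mu> y \<bullet> gradient (?K y \<mu>) (Wx t y \<mu>))"
    using transport by (simp add: shift_hamiltonian_def Wx_def gradient_shift)
  moreover have "\<beta> \<noteq> 0 \<or> \<beta>0 \<noteq> 0 \<longrightarrow>
      continuous_P2_on ({0<..<T} \<times> UNIV) (\<lambda>(t, x) \<mu>. Wxx t x \<mu>) \<and>
      continuous_P2_on ({0<..<T} \<times> UNIV \<times> UNIV) (\<lambda>(t, x, y) \<mu>. Vym t x \<mu> y) \<and>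
      (\<forall>t\<in>{0<..<T}. \<forall>x. \<forall>\<mu>\<in>P2.
         has_jacobian (\<lambda>x. Wx t x \<mu>) (Wxx t x \<mu>) x \<and>
         (\<forall>y. has_jacobian (\<lambda>y. Vm t x \<mu> y) (Vym t x \<mu> y) y) \<and>
         integrable \<mu> (\<lambda>y. trace (Vym t x \<mu> y)))"
    using second unfolding Wx_def Wxx_def split_beta
    by (auto intro!: continuous_P2_on_add_const_measure has_jacobian_add_scaleR)
  moreover have "\<forall>t\<in>{0<..<T}. \<forall>x. \<forall>\<mu>\<in>P2.
      - Wt t x \<mu> + ?K x \<mu> (Wx t x \<mu>) + transport_term ?K (Wx t) (Vm t) x \<mu>
      - \<beta>\<^sup>2 / 2 * ind_laplacian (Wxx t) (Vym t) x \<mu>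
      - \<beta>0\<^sup>2 / 2 * com_laplacian (Wxx t) (Vym t) (Vxm t) (Vmm t) x \<mu> = 0"
  proof (intro ballI allI)
    fix t x \<mu> assume t: "t \<in> {0<..<T}" and \<mu>: "\<mu> \<in> (P2 :: (real^'d) measure set)"
    have "?K x \<mu> (Wx t x \<mu>) = K x \<mu> (Vx t x \<mu>)"
      by (simp add: shift_hamiltonian_def Wx_def)
    then show "- Wt t x \<mu> + ?K x \<mu> (Wx t x \<mu>) + transport_term ?K (Wx t) (Vm t) x \<mu>
      - \<beta>\<^sup>2 / 2 * ind_laplacian (Wxx t) (Vym t) x \<mu>
      - \<beta>0\<^sup>2 / 2 * com_laplacian (Wxx t) (Vym t) (Vxm t) (Vmm t) x \<mu> = 0"
      \<comment> \<open>Relative to the equation for \<open>V\<close>, the time derivative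
        contributes + c, and the two Laplacians subtract \<beta>^2 / 2 and \<beta>0^2 / 2 times
        \<alpha> d. By the choice of \<open>c\<close> these add up to zero, also when a noise
        coefficient vanishes.\<close>
      using eqn[rule_format, OF t \<mu>, of x]
      unfolding Wt_def Wxx_def c_def Wx_def
        transport_term_shift ind_laplacian_shift com_laplacian_shift
      by (simp add: field_simps)
  qed
  \<comment> \<open>The conditions in \<open>common\<close> mention only \<open>Vm\<close>,
    \<open>Vxm\<close> and \<open>Vmm\<close>, so they carry over verbatim.\<close>
  ultimately show ?thesis
    unfolding classical_solution_def
    using Vm_cont common by (intro conjI exI[of _ Wt] exI[of _ Wx] exI[of _ Vm] exI[of _ Wxx]
      exI[of _ Vym] exI[of _ Vxm] exI[of _ Vmm])
qed

text \<open>Existence is transported forward. For uniqueness, a competitor for the shifted data is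
  pulled back with - \<alpha> and compared with \<open>V\<close> under the original data.\<close>

lemma master_well_posed_shift:
  fixes K :: "real^'d \<Rightarrow> (real^'d) measure \<Rightarrow> real^'d \<Rightarrow> real"
  assumes "master_well_posed \<Omega> T \<beta> \<beta>0 K \<Phi>"
  shows "master_well_posed \<Omega> T \<beta> \<beta>0 (shift_hamiltonian \<alpha> K) (shift_terminal \<alpha> \<Phi>)"
proof -
  let ?S = "shift_solution T \<beta> \<beta>0 :: real \<Rightarrow> (real \<Rightarrow> real^'d \<Rightarrow> (real^'d) measure \<Rightarrow> real) \<Rightarrow> _"
  obtain V where V: "classical_solution \<Omega> T \<beta> \<beta>0 K \<Phi> V"
    and unique: "\<And>V'. classical_solution \<Omega> T \<beta> \<beta>0 K \<Phi> V' \<Longrightarrow>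
      \<forall>t\<in>{0<..T}. \<forall>x. \<forall>\<mu>\<in>P2. V' t x \<mu> = V t x \<mu>"
    using assms unfolding master_well_posed_def by blast
  have "\<forall>t\<in>{0<..T}. \<forall>x. \<forall>\<mu>\<in>P2. W t x \<mu> = ?S \<alpha> V t x \<mu>"
    if "classical_solution \<Omega> T \<beta> \<beta>0 (shift_hamiltonian \<alpha> K) (shift_terminal \<alpha> \<Phi>) W" for W
  proof -
    have "classical_solution \<Omega> T \<beta> \<beta>0 K \<Phi> (?S (- \<alpha>) W)"
      using classical_solution_shift[OF that, of "- \<alpha>"]
      by (simp add: shift_hamiltonian_inverse shift_terminal_inverse)
    note W = unique[OF this]
    show ?thesis
    proof (intro ballI allI)
      fix t x \<mu> assume "t \<in> {0<..T}" and "\<mu> \<in> (P2 :: (real^'d) measure set)"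
      with W have "?S (- \<alpha>) W t x \<mu> = V t x \<mu>" by blast
      \<comment> \<open>The correction is linear in \<alpha>, so the one for - \<alpha> is moved
        across the equality as the one for \<alpha>.\<close>
      then show "W t x \<mu> = ?S \<alpha> V t x \<mu>"
        by (simp add: shift_solution_def)
    qed
  qed
  with classical_solution_shift[OF V] show ?thesis
    unfolding master_well_posed_def by blast
qed

theorem theorem3p4:
  fixes \<Omega> :: "'w measure"
    and T \<beta> \<beta>0 \<alpha> :: real
    and H :: "real^'d \<Rightarrow> (real^'d) measure \<Rightarrow> real^'d \<Rightarrow> real"
    and G :: "real^'d \<Rightarrow> (real^'d) measure \<Rightarrow> real"
  assumes "atomless_prob_space \<Omega>"
    and "T > 0"
    and "continuous_P2_on UNIV (\<lambda>(x, p) \<mu>. H x \<mu> p)"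
    and "continuous_P2_on UNIV G"
    and "\<forall>x. \<forall>\<mu>\<in>P2. \<forall>p. \<exists>D. GDERIV (H x \<mu>) p :> D"
    and "continuous_P2_on UNIV (\<lambda>(x, p) \<mu>. gradient (H x \<mu>) p)"
  shows "master_well_posed \<Omega> T \<beta> \<beta>0 H G \<longleftrightarrow>
         master_well_posed \<Omega> T \<beta> \<beta>0
           (\<lambda>x \<mu> p. H x \<mu> (p - \<alpha> *\<^sub>R x)) (\<lambda>x \<mu>. G x \<mu> + \<alpha> / 2 * (norm x)\<^sup>2)"
proof
  assume "master_well_posed \<Omega> T \<beta> \<beta>0 H G"
  from master_well_posed_shift[OF this, of \<alpha>]
  show "master_well_posed \<Omega> T \<beta> \<beta>0
      (\<lambda>x \<mu> p. H x \<mu> (p - \<alpha> *\<^sub>R x)) (\<lambda>x \<mu>. G x \<mu> + \<alpha> / 2 * (norm x)\<^sup>2)"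
    unfolding shift_hamiltonian_def shift_terminal_def .
next
  assume "master_well_posed \<Omega> T \<beta> \<beta>0
      (\<lambda>x \<mu> p. H x \<mu> (p - \<alpha> *\<^sub>R x)) (\<lambda>x \<mu>. G x \<mu> + \<alpha> / 2 * (norm x)\<^sup>2)"
  then have "master_well_posed \<Omega> T \<beta> \<beta>0 (shift_hamiltonian \<alpha> H) (shift_terminal \<alpha> G)"
    unfolding shift_hamiltonian_def shift_terminal_def .
  \<comment> \<open>The converse is the same implication started from the shifted data: the second
    shift returns exactly \<open>H\<close> and \<open>G\<close>, as equal functions.\<close>
  from master_well_posed_shift[OF this, of "- \<alpha>"]
  show "master_well_posed \<Omega> T \<beta> \<beta>0 H G"
    by (simp add: shift_hamiltonian_inverse shift_terminal_inverse)
qed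

end
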